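(* Let $(G,P)$ be a weak quasi-lattice ordered group with $P$ Noetherian. Then the collection $\mathcal{A}_{P_{\inf}}$ is equal to the algebra $\mathcal{B}_P$.
   Context: A weak quasi-lattice ordered group $(G,P)$ is a discrete group $G$ with a submonoid $P$ such that $P\cap P^{-1}=\{e\}$ and, whenever $p,q\in P$ satisfy $pP\cap qP\ne\emptyset$, there is a (unique) $p\vee q\in P$ with $pP\cap qP=(p\vee q)P$; otherwise $p\vee q=\infty$. $P$ is Noetherian if there is no infinite descending sequence for the proper factor relation ($p$ is a proper factor of $q$ if $q=xpy$ with $x,y\in P$ not both equal to $e$). An atom is $s\in P\setminus\{e\}$ that is not a product of two elements of $P\setminus\{e\}$; $P_a$ is the set of atoms. The minimal set $P_{\inf}$ is $\bigcup_{n\ge1}P_n$, where $P_1=P_a$ and, for $n\ge2$, $P_n=\{x^{-1}(x\vee p): x\in P_a,\ p\in P_{n-1},\ x\vee p<\infty\}$; equivalently, it is the smallest subset of $P$ containing $P_a$ and closed under $p\mapsto x^{-1}(x\vee p)$ for $x\in P_a$ with $x\vee p<\infty$. For finite $K\subset P$, $\Omega_K=\bigcap_{k\in K}(P\setminus kP)$, with $\Omega_\emptyset=P$. For a nonempty $R\subset P$, $\mathcal{A}_R$ is the collection of all finite (possibly empty) disjoint unions of sets $p\Omega_K$ with $p\in P$ and $K\subset R$ finite or empty; in particular $\emptyset\in\mathcal{A}_R$. An algebra of subsets of $P$ is a nonempty collection closed under complements and finite unions; $\mathcal{B}_P$ is the algebra generated by the sets $pP$, $p\in P$. *)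

theory Defs
  imports
    "HOL-Algebra.Coset"
    "HOL-Library.Disjoint_Sets"
    "HOL-Analysis.Sigma_Algebra"
begin

locale weak_quasi_lattice_ordered = group G + submonoid P G
  for P and G (structure) +
  assumes pointed: "P \<inter> set_inv P = {\<one>}"
    and join_exists:
      "\<lbrakk>p \<in> P; q \<in> P; (p <# P) \<inter> (q <# P) \<noteq> {}\<rbrakk>
        \<Longrightarrow> \<exists>r\<in>P. (p <# P) \<inter> (q <# P) = r <# P"

text \<open>The value \<open>None\<close> of \<open>join\<close> stands for \<open>p \<or> q = \<infinity>\<close>.
  The definite description is justified by \<open>join_unique\<close> below.\<close>

definition join :: "('a, 'b) monoid_scheme \<Rightarrow> 'a set \<Rightarrow> 'a \<Rightarrow> 'a \<Rightarrow> 'a option" where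
  "join G P p q =
    (if (p <#\<^bsub>G\<^esub> P) \<inter> (q <#\<^bsub>G\<^esub> P) \<noteq> {}
     then Some (THE r. r \<in> P \<and> (p <#\<^bsub>G\<^esub> P) \<inter> (q <#\<^bsub>G\<^esub> P) = r <#\<^bsub>G\<^esub> P)
     else None)"

context weak_quasi_lattice_ordered
begin

lemma principal_ideal_inj:
  assumes "r \<in> P" "s \<in> P" "r <# P = s <# P"
  shows "r = s"
proof -
  have mem: "t \<in> t <# P" if "t \<in> P" for t
    using that one_closed subset by (force simp: l_coset_def)
  obtain a where a: "a \<in> P" "r = s \<otimes> a"
    using mem[OF assms(1)] assms(3) by (auto simp: l_coset_def)
  obtain b where b: "b \<in> P" "s = r \<otimes> b"
    using mem[OF assms(2)] assms(3) by (auto simp: l_coset_def)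
  have c: "a \<in> carrier G" "b \<in> carrier G" "s \<in> carrier G"
    using a b assms subset by auto
  have "s \<otimes> (a \<otimes> b) = (s \<otimes> a) \<otimes> b"
    using c by (simp only: m_assoc)
  also have "\<dots> = s"
    using a(2) b(2) by metis
  finally have "a \<otimes> b = \<one>"
    using c by simp
  then have "a = inv b"
    using c by (metis inv_equality)
  then have "a \<in> P \<inter> set_inv P"
    using a(1) b(1) by (auto simp: SET_INV_def)
  then show "r = s"
    using pointed a c by simp
qed

lemma join_unique:
  assumes "p \<in> P" "q \<in> P" "(p <# P) \<inter> (q <# P) \<noteq> {}"
  shows "\<exists>!r. r \<in> P \<and> (p <# P) \<inter> (q <# P) = r <# P"
  using join_exists[OF assms] principal_ideal_inj by metis

end

definition proper_factor :: "('a, 'b) monoid_scheme \<Rightarrow> 'a set \<Rightarrow> 'a \<Rightarrow> 'a \<Rightarrow> bool" where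
  "proper_factor G P p q \<longleftrightarrow>
    (\<exists>x\<in>P. \<exists>y\<in>P. \<not> (x = \<one>\<^bsub>G\<^esub> \<and> y = \<one>\<^bsub>G\<^esub>) \<and> q = x \<otimes>\<^bsub>G\<^esub> p \<otimes>\<^bsub>G\<^esub> y)"

definition noetherian_submonoid :: "('a, 'b) monoid_scheme \<Rightarrow> 'a set \<Rightarrow> bool" where
  "noetherian_submonoid G P \<longleftrightarrow>
    \<not> (\<exists>f :: nat \<Rightarrow> 'a. (\<forall>n. f n \<in> P) \<and> (\<forall>n. proper_factor G P (f (Suc n)) (f n)))"

definition atoms :: "('a, 'b) monoid_scheme \<Rightarrow> 'a set \<Rightarrow> 'a set" where
  "atoms G P =
    {s \<in> P - {\<one>\<^bsub>G\<^esub>}.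
      \<not> (\<exists>x \<in> P - {\<one>\<^bsub>G\<^esub>}. \<exists>y \<in> P - {\<one>\<^bsub>G\<^esub>}. s = x \<otimes>\<^bsub>G\<^esub> y)}"

text \<open>Levels are numbered from \<open>0\<close>: \<open>minimal_level G P n\<close> is the set \<open>P\<^sub>n\<^sub>+\<^sub>1\<close>.\<close>

primrec minimal_level :: "('a, 'b) monoid_scheme \<Rightarrow> 'a set \<Rightarrow> nat \<Rightarrow> 'a set" where
  "minimal_level G P 0 = atoms G P"
| "minimal_level G P (Suc n) =
    {inv\<^bsub>G\<^esub> x \<otimes>\<^bsub>G\<^esub> r | x p r.
      x \<in> atoms G P \<and> p \<in> minimal_level G P n \<and> join G P x p = Some r}"

definition minimal_set :: "('a, 'b) monoid_scheme \<Rightarrow> 'a set \<Rightarrow> 'a set" where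
  "minimal_set G P = (\<Union>n. minimal_level G P n)"

text \<open>Intersecting with \<open>P\<close> only matters for empty \<open>K\<close>, where it yields \<open>Omega G P {} = P\<close>.\<close>

definition Omega :: "('a, 'b) monoid_scheme \<Rightarrow> 'a set \<Rightarrow> 'a set \<Rightarrow> 'a set" where
  "Omega G P K = P \<inter> (\<Inter>k\<in>K. P - (k <#\<^bsub>G\<^esub> P))"

definition disjoint_unions :: "('a, 'b) monoid_scheme \<Rightarrow> 'a set \<Rightarrow> 'a set \<Rightarrow> 'a set set" where
  "disjoint_unions G P R =
    {\<Union>C | C. finite C \<and> disjoint C \<and>
      C \<subseteq> {p <#\<^bsub>G\<^esub> Omega G P K | p K. p \<in> P \<and> finite K \<and> K \<subseteq> R}}"

definition ideal_algebra :: "('a, 'b) monoid_scheme \<Rightarrow> 'a set \<Rightarrow> 'a set set" where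
  "ideal_algebra G P = algebra P hull {p <#\<^bsub>G\<^esub> P | p. p \<in> P}"

end

theory Submission
  imports Defs
begin

text \<open>
  Call a set \<open>p \<Omega>\<^sub>K\<close> with \<open>K \<subseteq> P\<^sub>i\<^sub>n\<^sub>f\<close> finite a cell. The point is that the cells, together with
  the empty set, form a semiring of sets; the finite disjoint unions of its members are then a ring
  of sets, and even an algebra because \<open>P = \<one> \<Omega>\<^sub>\<emptyset>\<close> is a cell. This algebra contains every
  \<open>pP = p \<Omega>\<^sub>\<emptyset>\<close>, and every cell \<open>pP - (\<Union>k\<in>K. pkP)\<close> lies in any algebra that contains all \<open>pP\<close>, so
  it is the generated one.

  For the semiring property, the Noetherian condition says that \<open>P\<close> is generated by its atoms.
  It enters twice.

  \<^item> \<open>P\<^sub>i\<^sub>n\<^sub>f\<close> is closed under \<open>k \<mapsto> x\<inverse>(x \<or> k)\<close> for atoms \<open>x\<close> by construction, and taking this quotient by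
    \<open>xq\<close> amounts to taking it by \<open>x\<close> and then by \<open>q\<close>; hence \<open>P\<^sub>i\<^sub>n\<^sub>f\<close> is closed under it for all
    \<open>x \<in> P\<close> (\<open>minimal_set_quotient\<close>). It follows that \<open>pa \<cdot> P \<inter> p \<Omega>\<^sub>K = pa \<cdot> \<Omega>\<^sub>K\<^sub>'\<close> with \<open>K' \<subseteq> P\<^sub>i\<^sub>n\<^sub>f\<close>, and
    two cells based at \<open>p\<close> and \<open>q\<close> meet in a cell based at \<open>p \<or> q\<close>, or not at all (\<open>cells_Int\<close>).

  \<^item> The complement of \<open>x\<^sub>1\<cdots>x\<^sub>nP\<close>, with atoms \<open>x\<^sub>i\<close>, is the disjoint union of the cells
    \<open>x\<^sub>1\<cdots>x\<^sub>i\<^sub>-\<^sub>1 (P - x\<^sub>iP)\<close> (\<open>principal_complement\<close>). Beyond \<open>P - qP\<close>, the complement of a cell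
    \<open>q \<Omega>\<^sub>L\<close> contains the translate by \<open>q\<close> of the union of the \<open>kP\<close> with \<open>k \<in> L\<close>. Adding these ideals
    one at a time, each contributes a set \<open>kP \<inter> \<Omega>\<^sub>L\<^sub>'\<close>, which is a cell or empty by the first point
    (\<open>Omega_complement\<close>). So complements of cells, and with them differences of cells, are finite
    disjoint unions of cells.
\<close>

section \<open>Translates and principal right ideals\<close>

context group
begin

lemma l_coset_image: "a <# A = (\<otimes>) a ` A"
  by (auto simp: l_coset_def)

lemma l_coset_Int:
  assumes "a \<in> carrier G" "A \<subseteq> carrier G" "B \<subseteq> carrier G"
  shows "a <# (A \<inter> B) = (a <# A) \<inter> (a <# B)"
  unfolding l_coset_image using assms by (intro inj_on_image_Int[OF inj_on_cmult])

lemma l_coset_Diff: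
  assumes "a \<in> carrier G" "A \<subseteq> carrier G" "B \<subseteq> carrier G"
  shows "a <# (A - B) = (a <# A) - (a <# B)"
  unfolding l_coset_image using assms by (intro inj_on_image_set_diff[OF inj_on_cmult]) auto

lemma l_coset_Union: "a <# \<Union>C = \<Union>((<#) a ` C)"
  by (auto simp: l_coset_def)

end

context weak_quasi_lattice_ordered
begin

lemma in_carrier: "p \<in> P \<Longrightarrow> p \<in> carrier G"
  using subset by auto

lemma principal_subset: "p \<in> P \<Longrightarrow> p <# P \<subseteq> P"
  by (auto simp: l_coset_def)

lemma mem_principal: "p \<in> P \<Longrightarrow> p \<in> p <# P"
  using one_closed in_carrier by (auto simp: l_coset_def intro!: bexI[of _ \<one>])

lemma principal_mult: "p \<in> P \<Longrightarrow> q \<in> P \<Longrightarrow> p <# (q <# P) = (p \<otimes> q) <# P"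
  using subset by (intro lcos_m_assoc) auto

lemma principal_mult_subset: "p \<in> P \<Longrightarrow> q \<in> P \<Longrightarrow> (p \<otimes> q) <# P \<subseteq> p <# P"
  using in_carrier by (auto simp: l_coset_def m_assoc)

lemma principal_one: "\<one> <# P = P"
  using subset by (rule lcos_mult_one)

lemma Omega_subset: "Omega G P K \<subseteq> P"
  by (auto simp: Omega_def)

lemma Omega_carrier: "Omega G P K \<subseteq> carrier G"
  using Omega_subset subset by (rule order_trans)

lemma principal_carrier: "p \<in> P \<Longrightarrow> p <# P \<subseteq> carrier G"
  using principal_subset subset by (rule order_trans)

lemma Omega_empty: "Omega G P {} = P"
  by (simp add: Omega_def)

lemma Omega_eq_Diff: "Omega G P K = P - (\<Union>k\<in>K. k <# P)"
  by (auto simp: Omega_def)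

lemma join_eq_Some:
  assumes "p \<in> P" "q \<in> P" "(p <# P) \<inter> (q <# P) = r <# P" "r \<in> P"
  shows "join G P p q = Some r"
proof -
  have ne: "(p <# P) \<inter> (q <# P) \<noteq> {}"
    using mem_principal assms(3,4) by auto
  have "(THE r. r \<in> P \<and> (p <# P) \<inter> (q <# P) = r <# P) = r"
    using assms(3,4) by (intro the1_equality join_unique assms(1,2) ne) auto
  then show ?thesis
    using ne by (simp add: join_def)
qed

lemma join_SomeD:
  assumes "p \<in> P" "q \<in> P" "join G P p q = Some r"
  shows "r \<in> P" "(p <# P) \<inter> (q <# P) = r <# P"
proof -
  have ne: "(p <# P) \<inter> (q <# P) \<noteq> {}"
    using assms(3) by (auto simp: join_def)
  obtain s where s: "s \<in> P" "(p <# P) \<inter> (q <# P) = s <# P"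
    using join_exists[OF assms(1,2) ne] by blast
  have "s = r"
    using join_eq_Some[OF assms(1,2) s(2,1)] assms(3) by simp
  then show "r \<in> P" "(p <# P) \<inter> (q <# P) = r <# P"
    using s by auto
qed

lemma join_quotient:
  assumes "p \<in> P" "q \<in> P" "join G P p q = Some r"
  shows "inv p \<otimes> r \<in> P" "p \<otimes> (inv p \<otimes> r) = r"
proof -
  have "r \<in> p <# P"
    using join_SomeD[OF assms] mem_principal by blast
  then obtain a where "a \<in> P" "r = p \<otimes> a"
    by (auto simp: l_coset_def)
  then show "inv p \<otimes> r \<in> P" "p \<otimes> (inv p \<otimes> r) = r"
    using assms(1) in_carrier by (auto simp: m_assoc[symmetric])
qed

section \<open>The minimal set\<close>

lemma atoms_subset: "atoms G P \<subseteq> P"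
  by (auto simp: atoms_def)

lemma atoms_subset_minimal_set: "atoms G P \<subseteq> minimal_set G P"
  unfolding minimal_set_def by (rule order_trans[OF _ UN_upper[of 0]]) auto

lemma minimal_level_subset: "minimal_level G P n \<subseteq> P"
proof (induction n)
  case 0
  show ?case using atoms_subset by simp
next
  case (Suc n)
  show ?case
  proof
    fix y assume "y \<in> minimal_level G P (Suc n)"
    then obtain x p r where "y = inv x \<otimes> r" "x \<in> atoms G P" "p \<in> minimal_level G P n"
      "join G P x p = Some r"
      by auto
    then show "y \<in> P"
      using Suc.IH atoms_subset join_quotient(1) by blast
  qed
qed

lemma minimal_set_subset: "minimal_set G P \<subseteq> P"
  using minimal_level_subset by (auto simp: minimal_set_def)

lemma minimal_set_atom_quotient:
  assumes x: "x \<in> atoms G P" and k: "k \<in> minimal_set G P"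
    and meet: "(x <# P) \<inter> (k <# P) \<noteq> {}"
  shows "\<exists>k'\<in>minimal_set G P. (x <# P) \<inter> (k <# P) = (x \<otimes> k') <# P"
proof -
  have P: "x \<in> P" "k \<in> P"
    using x k atoms_subset minimal_set_subset by auto
  obtain r where r: "r \<in> P" "(x <# P) \<inter> (k <# P) = r <# P"
    using join_exists[OF P meet] by blast
  have j: "join G P x k = Some r"
    using join_eq_Some[OF P r(2,1)] .
  obtain n where "k \<in> minimal_level G P n"
    using k by (auto simp: minimal_set_def)
  then have "inv x \<otimes> r \<in> minimal_level G P (Suc n)"
    using x j by auto
  then have "inv x \<otimes> r \<in> minimal_set G P"
    unfolding minimal_set_def by blast
  then show ?thesis
    using r(2) join_quotient(2)[OF P j] by (intro bexI[of _ "inv x \<otimes> r"]) simp_all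
qed

end

locale noetherian_weak_quasi_lattice_ordered = weak_quasi_lattice_ordered +
  assumes noetherian: "noetherian_submonoid G P"
begin

lemma wf_proper_factor: "wf {(p, q). p \<in> P \<and> q \<in> P \<and> proper_factor G P p q}"
  using noetherian unfolding noetherian_submonoid_def wf_iff_no_infinite_down_chain by auto

text \<open>
  A product \<open>xy\<close> of nontrivial elements has both \<open>x\<close> and \<open>y\<close> as proper factors. So an atom can be
  split off on the left of every nontrivial element: split off one from \<open>x\<close> if the element is not
  itself an atom.
\<close>

lemma left_atom:
  assumes "p \<in> P" "p \<noteq> \<one>"
  shows "\<exists>x\<in>atoms G P. \<exists>q\<in>P. p = x \<otimes> q"
  using wf_proper_factor assms
proof (induction p rule: wf_induct_rule)
  case (less p)
  show ?case
  proof (cases "p \<in> atoms G P")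
    case True
    then show ?thesis
      using less.prems in_carrier one_closed by (metis r_one)
  next
    case False
    then obtain x y where xy: "x \<in> P" "x \<noteq> \<one>" "y \<in> P" "y \<noteq> \<one>" "p = x \<otimes> y"
      using less.prems by (auto simp: atoms_def)
    have "p = \<one> \<otimes> x \<otimes> y"
      using xy in_carrier by simp
    then have "proper_factor G P x p"
      unfolding proper_factor_def using xy one_closed by blast
    then obtain a z where "a \<in> atoms G P" "z \<in> P" "x = a \<otimes> z"
      using less.IH[of x] less.prems xy by blast
    moreover from this have "p = a \<otimes> (z \<otimes> y)"
      using xy in_carrier atoms_subset by (metis m_assoc subsetD)
    ultimately show ?thesis
      using xy by blast
  qed
qed

lemma atom_induct [consumes 1, case_names one mult]:
  assumes "p \<in> P"
    and one: "Q \<one>"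
    and mult: "\<And>x q. x \<in> atoms G P \<Longrightarrow> q \<in> P \<Longrightarrow> Q q \<Longrightarrow> Q (x \<otimes> q)"
  shows "Q p"
  using wf_proper_factor assms(1)
proof (induction p rule: wf_induct_rule)
  case (less p)
  show ?case
  proof (cases "p = \<one>")
    case True
    then show ?thesis using one by simp
  next
    case False
    then obtain x q where xq: "x \<in> atoms G P" "q \<in> P" "p = x \<otimes> q"
      using left_atom less.prems by blast
    have x: "x \<in> P" "x \<noteq> \<one>"
      using xq(1) by (auto simp: atoms_def)
    have "p = x \<otimes> q \<otimes> \<one>"
      using xq x in_carrier by simp
    then have "proper_factor G P q p"
      unfolding proper_factor_def using x one_closed by blast
    then have "Q q"
      using less.IH[of q] less.prems xq by blast
    then show ?thesis
      using mult xq by blast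
  qed
qed

text \<open>
  The element \<open>k'\<close> is \<open>x\<inverse>(x \<or> k)\<close>. For a product \<open>xq\<close> it can be computed in two steps,
  because \<open>xqP \<inter> kP = xqP \<inter> (xP \<inter> kP) = x (qP \<inter> k\<^sub>1P)\<close> with \<open>k\<^sub>1 = x\<inverse>(x \<or> k)\<close>.
\<close>

lemma minimal_set_quotient:
  assumes "x \<in> P" "k \<in> minimal_set G P" "(x <# P) \<inter> (k <# P) \<noteq> {}"
  shows "\<exists>k'\<in>minimal_set G P. (x <# P) \<inter> (k <# P) = (x \<otimes> k') <# P"
  using assms
proof (induction x arbitrary: k rule: atom_induct)
  case one
  have "k \<in> P"
    using one minimal_set_subset by auto
  then have "(\<one> <# P) \<inter> (k <# P) = (\<one> \<otimes> k) <# P"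
    using principal_subset in_carrier by (auto simp: principal_one)
  then show ?case
    using one by blast
next
  case (mult x q)
  have P: "x \<in> P" "q \<in> P" "k \<in> P"
    using mult atoms_subset minimal_set_subset by auto
  have sub: "(x \<otimes> q) <# P \<subseteq> x <# P"
    using principal_mult_subset P by auto
  then obtain k1 where k1: "k1 \<in> minimal_set G P" "(x <# P) \<inter> (k <# P) = (x \<otimes> k1) <# P"
    using minimal_set_atom_quotient[OF mult(1)] mult.prems by blast
  have k1P: "k1 \<in> P"
    using k1 minimal_set_subset by auto
  have "((x \<otimes> q) <# P) \<inter> (k <# P) = ((x \<otimes> q) <# P) \<inter> ((x \<otimes> k1) <# P)"
    using sub k1(2) by blast
  also have "\<dots> = x <# ((q <# P) \<inter> (k1 <# P))"
    using P k1P in_carrier by (simp add: l_coset_Int principal_carrier principal_mult)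
  finally have eq: "((x \<otimes> q) <# P) \<inter> (k <# P) = x <# ((q <# P) \<inter> (k1 <# P))" .
  then have "(q <# P) \<inter> (k1 <# P) \<noteq> {}"
    using mult.prems by (auto simp: l_coset_def)
  then obtain k2 where k2: "k2 \<in> minimal_set G P" "(q <# P) \<inter> (k1 <# P) = (q \<otimes> k2) <# P"
    using mult.IH k1 by blast
  have k2P: "k2 \<in> P"
    using k2 minimal_set_subset by auto
  have "x <# ((q \<otimes> k2) <# P) = (x \<otimes> q \<otimes> k2) <# P"
    using P k2P in_carrier by (simp add: principal_mult m_assoc)
  then show ?case
    unfolding eq k2(2) using k2(1) by blast
qed

section \<open>The semiring of cells\<close>

definition cells :: "'a set set" where
  "cells = {p <# Omega G P K | p K. p \<in> P \<and> finite K \<and> K \<subseteq> minimal_set G P}"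

abbreviation disjoint_cell_unions :: "'a set set" where
  "disjoint_cell_unions \<equiv> disjoint_unions G P (minimal_set G P)"

lemma cellI: "p \<in> P \<Longrightarrow> finite K \<Longrightarrow> K \<subseteq> minimal_set G P \<Longrightarrow> p <# Omega G P K \<in> cells"
  by (auto simp: cells_def)

lemma principal_in_cells: "p \<in> P \<Longrightarrow> p <# P \<in> cells"
  using cellI[of p "{}"] by (simp add: Omega_empty)

lemma l_coset_cell:
  assumes p: "p \<in> P" and A: "A \<in> cells"
  shows "p <# A \<in> cells"
proof -
  obtain q K where "A = q <# Omega G P K" "q \<in> P" "finite K" "K \<subseteq> minimal_set G P"
    using A by (auto simp: cells_def)
  then show ?thesis
    using p in_carrier Omega_carrier cellI[of "p \<otimes> q" K] by (simp add: lcos_m_assoc)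
qed

lemma Omega_in_cells: "finite K \<Longrightarrow> K \<subseteq> minimal_set G P \<Longrightarrow> Omega G P K \<in> cells"
  using cellI[of \<one> K] Omega_carrier by (simp add: lcos_mult_one)

lemma cells_subset: "A \<in> cells \<Longrightarrow> A \<subseteq> P"
  using Omega_subset by (auto simp: cells_def l_coset_def)

text \<open>
  Removing the ideals \<open>pkP\<close> from \<open>paP \<subseteq> pP\<close> is the same as removing the ideals
  \<open>paP \<inter> pkP = p (aP \<inter> kP)\<close>, which are empty or of the form \<open>pak'P\<close> with \<open>k'\<close> in the
  minimal set.
\<close>

lemma principal_Int_cell:
  assumes p: "p \<in> P" and a: "a \<in> P" and K: "finite K" "K \<subseteq> minimal_set G P"
  shows "\<exists>K'. finite K' \<and> K' \<subseteq> minimal_set G P \<and>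
    ((p \<otimes> a) <# P) \<inter> (p <# Omega G P K) = (p \<otimes> a) <# Omega G P K'"
proof -
  define L where "L = {k \<in> K. (a <# P) \<inter> (k <# P) \<noteq> {}}"
  have "\<forall>k\<in>L. \<exists>k'\<in>minimal_set G P. (a <# P) \<inter> (k <# P) = (a \<otimes> k') <# P"
    using minimal_set_quotient a K by (auto simp: L_def)
  then obtain f where f: "\<And>k. k \<in> L \<Longrightarrow> f k \<in> minimal_set G P"
      "\<And>k. k \<in> L \<Longrightarrow> (a <# P) \<inter> (k <# P) = (a \<otimes> f k) <# P"
    by metis
  have fP: "f k \<in> P" if "k \<in> L" for k
    using f(1)[OF that] minimal_set_subset by auto
  have ideals: "(\<Union>k\<in>f ` L. k <# P) \<subseteq> carrier G"
    using fP principal_subset subset by blast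
  have "(a <# P) \<inter> Omega G P K = (a <# P) - (\<Union>k\<in>L. (a <# P) \<inter> (k <# P))"
    using principal_subset[OF a] by (auto simp: Omega_eq_Diff L_def)
  also have "\<dots> = (a <# P) - (\<Union>k\<in>L. (a \<otimes> f k) <# P)"
    using f(2) by auto
  also have "\<dots> = (a <# P) - (\<Union>k\<in>L. a <# (f k <# P))"
    using principal_mult[OF a] fP by auto
  also have "\<dots> = (a <# P) - (a <# (\<Union>k\<in>f ` L. k <# P))"
    by (auto simp: l_coset_def)
  also have "\<dots> = a <# Omega G P (f ` L)"
    using a in_carrier subset ideals by (simp add: l_coset_Diff Omega_eq_Diff)
  finally have eq: "(a <# P) \<inter> Omega G P K = a <# Omega G P (f ` L)" .
  have "((p \<otimes> a) <# P) \<inter> (p <# Omega G P K) = p <# ((a <# P) \<inter> Omega G P K)"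
    using p a in_carrier
    by (simp add: l_coset_Int principal_carrier Omega_carrier principal_mult)
  also have "\<dots> = (p \<otimes> a) <# Omega G P (f ` L)"
    unfolding eq using p a in_carrier by (simp add: lcos_m_assoc Omega_carrier)
  finally show ?thesis
    using K f(1) by (intro exI[of _ "f ` L"]) (auto simp: L_def)
qed

text \<open>
  If \<open>pP \<inter> qP = rP\<close>, both cells can be restricted to \<open>rP\<close> by the previous lemma. They then have the
  common base \<open>r\<close>, and two cells with the same base meet in the cell of the union of their index sets.
\<close>

lemma cells_Int:
  assumes A: "A \<in> cells" and B: "B \<in> cells" and meet: "A \<inter> B \<noteq> {}"
  shows "A \<inter> B \<in> cells"
proof -
  obtain p K where A': "A = p <# Omega G P K" "p \<in> P" "finite K" "K \<subseteq> minimal_set G P"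
    using A by (auto simp: cells_def)
  obtain q L where B': "B = q <# Omega G P L" "q \<in> P" "finite L" "L \<subseteq> minimal_set G P"
    using B by (auto simp: cells_def)
  have sub: "A \<subseteq> p <# P" "B \<subseteq> q <# P"
    using A' B' Omega_subset by (force simp: l_coset_def)+
  obtain r where r: "r \<in> P" "(p <# P) \<inter> (q <# P) = r <# P"
    using join_exists[OF A'(2) B'(2)] sub meet by blast
  have "r \<in> p <# P" "r \<in> q <# P"
    using r mem_principal by auto
  then obtain a b where ab: "a \<in> P" "r = p \<otimes> a" "b \<in> P" "r = q \<otimes> b"
    by (auto simp: l_coset_def)
  obtain K' where K': "finite K'" "K' \<subseteq> minimal_set G P" "(r <# P) \<inter> A = r <# Omega G P K'"
    using principal_Int_cell[OF A'(2) ab(1) A'(3,4)] A'(1) ab(2) by auto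
  obtain L' where L': "finite L'" "L' \<subseteq> minimal_set G P" "(r <# P) \<inter> B = r <# Omega G P L'"
    using principal_Int_cell[OF B'(2) ab(3) B'(3,4)] B'(1) ab(4) by auto
  have "A \<inter> B = ((r <# P) \<inter> A) \<inter> ((r <# P) \<inter> B)"
    using sub r(2) by blast
  also have "\<dots> = r <# (Omega G P K' \<inter> Omega G P L')"
    unfolding K'(3) L'(3) using r(1) in_carrier by (simp add: l_coset_Int Omega_carrier)
  also have "Omega G P K' \<inter> Omega G P L' = Omega G P (K' \<union> L')"
    by (auto simp: Omega_def)
  finally show ?thesis
    using cellI[OF r(1), of "K' \<union> L'"] K' L' by simp
qed

lemma disjoint_cell_unions_eq:
  "disjoint_cell_unions = {\<Union>C | C. finite C \<and> disjoint C \<and> C \<subseteq> cells}"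
  by (simp add: disjoint_unions_def cells_def)

lemma disjoint_cell_unions_empty: "{} \<in> disjoint_cell_unions"
  unfolding disjoint_cell_unions_eq by (rule CollectI, rule exI[of _ "{}"]) (auto simp: disjoint_def)

lemma cell_in_disjoint_cell_unions: "A \<in> cells \<Longrightarrow> A \<in> disjoint_cell_unions"
  unfolding disjoint_cell_unions_eq by (rule CollectI, rule exI[of _ "{A}"]) (auto simp: disjoint_def)

lemma disjoint_cell_unions_Un:
  assumes "A \<in> disjoint_cell_unions" "B \<in> disjoint_cell_unions" "A \<inter> B = {}"
  shows "A \<union> B \<in> disjoint_cell_unions"
proof -
  obtain C D where "A = \<Union>C" "finite C" "disjoint C" "C \<subseteq> cells"
    "B = \<Union>D" "finite D" "disjoint D" "D \<subseteq> cells"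
    using assms(1,2) unfolding disjoint_cell_unions_eq by blast
  then show ?thesis
    using assms(3) unfolding disjoint_cell_unions_eq
    by (intro CollectI exI[of _ "C \<union> D"]) (auto intro!: disjoint_union)
qed

lemma l_coset_disjoint_cell_unions:
  assumes p: "p \<in> P" and A: "A \<in> disjoint_cell_unions"
  shows "p <# A \<in> disjoint_cell_unions"
proof -
  obtain C where C: "A = \<Union>C" "finite C" "disjoint C" "C \<subseteq> cells"
    using A unfolding disjoint_cell_unions_eq by blast
  have "disjoint ((<#) p ` C)"
  proof (rule disjointI)
    fix X Y assume "X \<in> (<#) p ` C" "Y \<in> (<#) p ` C" "X \<noteq> Y"
    then obtain U V where UV: "U \<in> C" "V \<in> C" "U \<noteq> V" "X = p <# U" "Y = p <# V"
      by auto
    have "U \<subseteq> carrier G" "V \<subseteq> carrier G"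
      using UV C(4) cells_subset subset by blast+
    then have "X \<inter> Y = p <# (U \<inter> V)"
      using p in_carrier by (simp add: UV l_coset_Int)
    also have "U \<inter> V = {}"
      using disjointD[OF C(3)] UV by blast
    finally show "X \<inter> Y = {}"
      by (simp add: l_coset_def)
  qed
  moreover have "(<#) p ` C \<subseteq> cells"
    using C(4) l_coset_cell[OF p] by auto
  ultimately show ?thesis
    using C(1,2) unfolding disjoint_cell_unions_eq C(1) l_coset_Union
    by blast
qed

text \<open>
  The induction peels off atoms: \<open>P - xqP\<close> is the disjoint union of \<open>P - xP = \<Omega>\<close> of \<open>{x}\<close> and
  \<open>x (P - qP)\<close>. The first part is a cell since atoms belong to the minimal set.
\<close>

lemma principal_complement:
  assumes "p \<in> P"
  shows "P - (p <# P) \<in> disjoint_cell_unions"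
  using assms
proof (induction p rule: atom_induct)
  case one
  show ?case
    by (simp add: principal_one disjoint_cell_unions_empty)
next
  case (mult x q)
  have x: "x \<in> P"
    using mult atoms_subset by auto
  have "x <# (P - (q <# P)) = (x <# P) - ((x \<otimes> q) <# P)"
    using x mult(2) in_carrier subset by (simp add: l_coset_Diff principal_carrier principal_mult)
  then have "P - ((x \<otimes> q) <# P) = Omega G P {x} \<union> (x <# (P - (q <# P)))"
    and "Omega G P {x} \<inter> (x <# (P - (q <# P))) = {}"
    using principal_mult_subset[OF x mult(2)] principal_subset[OF x]
    by (auto simp: Omega_eq_Diff)
  moreover have "Omega G P {x} \<in> disjoint_cell_unions"
    using mult(1) atoms_subset_minimal_set
    by (intro cell_in_disjoint_cell_unions Omega_in_cells) auto
  moreover have "x <# (P - (q <# P)) \<in> disjoint_cell_unions"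
    using l_coset_disjoint_cell_unions x mult.IH by blast
  ultimately show ?case
    using disjoint_cell_unions_Un by simp
qed

lemma Omega_complement:
  assumes "finite L" "L \<subseteq> minimal_set G P"
  shows "P - Omega G P L \<in> disjoint_cell_unions"
  using assms
proof (induction L)
  case empty
  show ?case
    by (simp add: Omega_empty disjoint_cell_unions_empty)
next
  case (insert k L)
  have k: "k \<in> P"
    using insert.prems minimal_set_subset by auto
  \<comment> \<open>The part of \<open>kP\<close> outside the ideals already united is an intersection of two cells.\<close>
  have eq: "P - Omega G P (insert k L) = (P - Omega G P L) \<union> ((k <# P) \<inter> Omega G P L)"
    using principal_subset[OF k] by (auto simp: Omega_eq_Diff)
  have "(k <# P) \<inter> Omega G P L \<in> disjoint_cell_unions"
  proof (cases "(k <# P) \<inter> Omega G P L = {}")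
    case True
    then show ?thesis
      by (simp only: disjoint_cell_unions_empty)
  next
    case False
    then show ?thesis
      using cells_Int principal_in_cells[OF k] Omega_in_cells insert
      by (intro cell_in_disjoint_cell_unions) auto
  qed
  then show ?case
    unfolding eq using insert by (intro disjoint_cell_unions_Un) auto
qed

lemma cell_complement:
  assumes "A \<in> cells"
  shows "P - A \<in> disjoint_cell_unions"
proof -
  obtain q L where A: "A = q <# Omega G P L" "q \<in> P" "finite L" "L \<subseteq> minimal_set G P"
    using assms by (auto simp: cells_def)
  have eq: "q <# (P - Omega G P L) = (q <# P) - A"
    unfolding A(1) using A(2) in_carrier subset by (simp add: l_coset_Diff Omega_carrier)
  have "A \<subseteq> q <# P"
    using A(1) Omega_subset by (force simp: l_coset_def)
  then have "P - A = (P - (q <# P)) \<union> (q <# (P - Omega G P L))"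
    and "(P - (q <# P)) \<inter> (q <# (P - Omega G P L)) = {}"
    unfolding eq using principal_subset[OF A(2)] by auto
  then show ?thesis
    using disjoint_cell_unions_Un principal_complement[OF A(2)]
      l_coset_disjoint_cell_unions[OF A(2) Omega_complement[OF A(3,4)]]
    by simp
qed

text \<open>
  The empty set has to be added: for \<open>P = {\<one>}\<close> there are no atoms and \<open>P\<close> is the only cell.
\<close>

lemma semiring_of_cells: "semiring_of_sets P (insert {} cells)"
proof
  show "insert {} cells \<subseteq> Pow P"
    using cells_subset by auto
  show "{} \<in> insert {} cells"
    by simp
  show Int: "a \<inter> b \<in> insert {} cells" if "a \<in> insert {} cells" "b \<in> insert {} cells" for a b
    using that cells_Int by auto
  show "\<exists>C\<subseteq>insert {} cells. finite C \<and> disjoint C \<and> a - b = \<Union>C"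
    if a: "a \<in> insert {} cells" and b: "b \<in> insert {} cells" for a b
  proof (cases "b = {}")
    case True
    then show ?thesis
      using a by (intro exI[of _ "{a}"]) (auto simp: disjoint_def)
  next
    case False
    then have "P - b \<in> disjoint_cell_unions"
      using cell_complement b by auto
    then obtain C where C: "P - b = \<Union>C" "finite C" "disjoint C" "C \<subseteq> cells"
      unfolding disjoint_cell_unions_eq by auto
    \<comment> \<open>Cut the pieces of the complement of \<open>b\<close> down to \<open>a\<close>.\<close>
    have "a \<subseteq> P"
      using a cells_subset by auto
    then have "a - b = a \<inter> (P - b)"
      by blast
    then have "a - b = \<Union>((\<inter>) a ` C)"
      unfolding C(1) by auto
    moreover have "disjoint ((\<inter>) a ` C)"
    proof (rule disjointI)
      fix X Y assume "X \<in> (\<inter>) a ` C" "Y \<in> (\<inter>) a ` C" "X \<noteq> Y"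
      then obtain U V where "U \<in> C" "V \<in> C" "U \<noteq> V" "X = a \<inter> U" "Y = a \<inter> V"
        by auto
      then show "X \<inter> Y = {}"
        using disjointD[OF C(3), of U V] by auto
    qed
    ultimately show ?thesis
      using C(2,4) Int[OF a] by (intro exI[of _ "(\<inter>) a ` C"]) auto
  qed
qed

section \<open>The algebra generated by the principal right ideals\<close>

lemma algebra_disjoint_cell_unions: "algebra P disjoint_cell_unions"
proof -
  interpret semiring_of_sets P "insert {} cells"
    by (rule semiring_of_cells)
  have "generated_ring = disjoint_cell_unions"
  proof (intro equalityI subsetI)
    fix A assume "A \<in> generated_ring"
    then obtain C where C: "finite C" "disjoint C" "C \<subseteq> insert {} cells" "A = \<Union>C"
      by (rule generated_ringE)
    then show "A \<in> disjoint_cell_unions"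
      unfolding disjoint_cell_unions_eq
      by (intro CollectI exI[of _ "C - {{}}"]) (auto simp: disjoint_def)
  next
    fix A assume "A \<in> disjoint_cell_unions"
    then show "A \<in> generated_ring"
      unfolding disjoint_cell_unions_eq generated_ring_def by blast
  qed
  then interpret D: ring_of_sets P disjoint_cell_unions
    using generating_ring by simp
  have "P \<in> disjoint_cell_unions"
    using cell_in_disjoint_cell_unions principal_in_cells[OF one_closed]
    by (simp add: principal_one)
  then show ?thesis
    by unfold_locales
qed

lemma disjoint_cell_unions_least:
  assumes "algebra P S" and ideals: "{p <# P | p. p \<in> P} \<subseteq> S"
  shows "disjoint_cell_unions \<subseteq> S"
proof -
  interpret algebra P S by fact
  have "A \<in> S" if "A \<in> cells" for A
  proof -
    obtain p K where A: "A = p <# Omega G P K" "p \<in> P" "finite K" "K \<subseteq> minimal_set G P"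
      using \<open>A \<in> cells\<close> by (auto simp: cells_def)
    have K: "K \<subseteq> P"
      using A(4) minimal_set_subset by auto
    have "A = (p <# P) - (p <# (\<Union>k\<in>K. k <# P))"
      unfolding A(1) Omega_eq_Diff using A(2) K in_carrier subset principal_subset
      by (intro l_coset_Diff) blast+
    also have "p <# (\<Union>k\<in>K. k <# P) = (\<Union>k\<in>K. (p \<otimes> k) <# P)"
      using principal_mult[OF A(2)] K by (auto simp: l_coset_Union)
    finally have "A = (p <# P) - (\<Union>k\<in>K. (p \<otimes> k) <# P)" .
    moreover have "(\<Union>k\<in>K. (p \<otimes> k) <# P) \<in> S"
      using A(2,3) K ideals by (intro finite_UN) auto
    ultimately show ?thesis
      using A(2) ideals by auto
  qed
  then show ?thesis
    unfolding disjoint_cell_unions_eq by (auto intro!: finite_Union)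
qed

lemma disjoint_cell_unions_eq_ideal_algebra: "disjoint_cell_unions = ideal_algebra G P"
  unfolding ideal_algebra_def
proof (rule hull_unique[symmetric])
  show "{p <# P | p. p \<in> P} \<subseteq> disjoint_cell_unions"
    using cell_in_disjoint_cell_unions principal_in_cells by auto
qed (use algebra_disjoint_cell_unions disjoint_cell_unions_least in auto)

end

theorem lemma5p4:
  fixes G :: "('a, 'b) monoid_scheme" and P :: "'a set"
  assumes "weak_quasi_lattice_ordered P G"
    and "noetherian_submonoid G P"
  shows "disjoint_unions G P (minimal_set G P) = ideal_algebra G P"
proof -
  interpret noetherian_weak_quasi_lattice_ordered P G
    using assms by (intro noetherian_weak_quasi_lattice_ordered.intro
        noetherian_weak_quasi_lattice_ordered_axioms.intro)
  show ?thesis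
    by (rule disjoint_cell_unions_eq_ideal_algebra)
qed

end
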